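(* Let $X$ be a topological space and $\hat\delta$ a strong proximity on $X$. If $X$ is $\hat\delta$-connected, then $X$ is connected.
   Context: A strong proximity on a topological space $X$ is a binary relation $\hat\delta$ on the power set of $X$ such that, for all $A,B\subseteq X$ and $x,y\in X$ (writing $x\,\hat\delta\,A$ for $\{x\}\,\hat\delta\,A$): (N0) $\emptyset\,\hat\delta\,A$ fails for every $A\subseteq X$, and $X\,\hat\delta\,A$ for every nonempty $A\subseteq X$; (N1) $A\,\hat\delta\,B\iff B\,\hat\delta\,A$; (N2) $A\,\hat\delta\,B\Rightarrow A\cap B\neq\emptyset$; (N3) if $\{B_i\}_{i\in I}$ is an arbitrary family of subsets of $X$ and $A\,\hat\delta\,B_{i^*}$ for some $i^*\in I$ with $\mathrm{int}(B_{i^*})\neq\emptyset$, then $A\,\hat\delta\,\bigcup_{i\in I}B_i$; (N4) $\mathrm{int}(A)\cap\mathrm{int}(B)\neq\emptyset\Rightarrow A\,\hat\delta\,B$; (N5) $x\in\mathrm{int}(A)\Rightarrow x\,\hat\delta\,A$; (N6) $\{x\}\,\hat\delta\,\{y\}\iff x=y$. $X$ is $\hat\delta$-connected if $X=\bigcup_{i\in I}X_i$, where $I=\{1,\dots,n\}$ for some $n\ge 1$ or $I=\{1,2,3,\dots\}$, the sets $X_i$ and $\mathrm{int}(X_i)$ are connected for each $i\in I$, and $X_{i-1}\,\hat\delta\,X_i$ for each $i\in I$ with $i\geq 2$. The empty set is regarded as connected. *)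

theory Defs
  imports "HOL-Analysis.Abstract_Topology"
begin

text \<open>
  The relation is only constrained on subsets of the space, so its values on sets that are
  not contained in \<^term>\<open>topspace T\<close> are irrelevant. In (N3) the family is given by its range
  \<open>\<B>\<close>, which loses nothing since neither the hypothesis nor the union depends on the indexing.
\<close>

definition strong_proximity :: "'a topology \<Rightarrow> ('a set \<Rightarrow> 'a set \<Rightarrow> bool) \<Rightarrow> bool" where
  "strong_proximity T \<delta> \<longleftrightarrow>
     \<comment> \<open>(N0)\<close>
     (\<forall>A \<subseteq> topspace T. \<not> \<delta> {} A) \<and>
     (\<forall>A \<subseteq> topspace T. A \<noteq> {} \<longrightarrow> \<delta> (topspace T) A) \<and>
     \<comment> \<open>(N1)\<close>
     (\<forall>A \<subseteq> topspace T. \<forall>B \<subseteq> topspace T. \<delta> A B \<longleftrightarrow> \<delta> B A) \<and>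
     \<comment> \<open>(N2)\<close>
     (\<forall>A \<subseteq> topspace T. \<forall>B \<subseteq> topspace T. \<delta> A B \<longrightarrow> A \<inter> B \<noteq> {}) \<and>
     \<comment> \<open>(N3)\<close>
     (\<forall>A \<subseteq> topspace T. \<forall>\<B> \<subseteq> Pow (topspace T).
        (\<exists>B\<in>\<B>. \<delta> A B \<and> T interior_of B \<noteq> {}) \<longrightarrow> \<delta> A (\<Union>\<B>)) \<and>
     \<comment> \<open>(N4)\<close>
     (\<forall>A \<subseteq> topspace T. \<forall>B \<subseteq> topspace T.
        T interior_of A \<inter> T interior_of B \<noteq> {} \<longrightarrow> \<delta> A B) \<and>
     \<comment> \<open>(N5)\<close>
     (\<forall>A \<subseteq> topspace T. \<forall>x \<in> topspace T. x \<in> T interior_of A \<longrightarrow> \<delta> {x} A) \<and>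
     \<comment> \<open>(N6)\<close>
     (\<forall>x \<in> topspace T. \<forall>y \<in> topspace T. \<delta> {x} {y} \<longleftrightarrow> x = y)"

text \<open>
  \<^const>\<open>connectedin\<close> includes being a subset of the space, and holds for the empty set.
\<close>

definition proximity_connected :: "'a topology \<Rightarrow> ('a set \<Rightarrow> 'a set \<Rightarrow> bool) \<Rightarrow> bool" where
  "proximity_connected T \<delta> \<longleftrightarrow>
     (\<exists>(I :: nat set) X.
        ((\<exists>n\<ge>1. I = {1..n}) \<or> I = {1..}) \<and>
        topspace T = (\<Union>i\<in>I. X i) \<and>
        (\<forall>i\<in>I. connectedin T (X i) \<and> connectedin T (T interior_of X i)) \<and>
        (\<forall>i\<in>I. 2 \<le> i \<longrightarrow> \<delta> (X (i - 1)) (X i)))"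

end

theory Submission
  imports Defs
begin

text \<open>By (N2), near sets intersect, so the cover in the definition of
  \<open>proximity_connected\<close> is a chain of connected sets in which consecutive members meet.
  The union of such a chain is connected: a finite chain is handled by adding one link at a time
  (\<open>connectedin_chain\<close>), an infinite one by taking the increasing union of its finite
  initial segments (\<open>connectedin_infinite_chain\<close>). Since the chain covers the space,
  the space is connected.\<close>

lemma connectedin_chain:
  fixes X :: "nat \<Rightarrow> 'a set"
  assumes "\<And>i. i \<in> {1..n} \<Longrightarrow> connectedin T (X i)"
    and "\<And>i. i \<in> {2..n} \<Longrightarrow> X (i - 1) \<inter> X i \<noteq> {}"
  shows "connectedin T (\<Union>i\<in>{1..n}. X i)"
  using assms
proof (induction n)
  case 0
  then show ?case by simp
next
  case (Suc n)
  have IH: "connectedin T (\<Union>i\<in>{1..n}. X i)"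
    using Suc by simp
  have last: "connectedin T (X (Suc n))"
    using Suc.prems(1) by simp
  have un: "(\<Union>i\<in>{1..Suc n}. X i) = (\<Union>i\<in>{1..n}. X i) \<union> X (Suc n)"
    by (auto simp: atLeastAtMostSuc_conv)
  \<comment> \<open>For \<open>n = 0\<close> the union built so far is empty and cannot meet the new
    link, so the first link is treated separately.\<close>
  show ?case
  proof (cases "n = 0")
    case True
    then show ?thesis using last by simp
  next
    case False
    then have "X n \<inter> X (Suc n) \<noteq> {}"
      using Suc.prems(2)[of "Suc n"] by simp
    then have "(\<Union>i\<in>{1..n}. X i) \<inter> X (Suc n) \<noteq> {}"
      using False by fastforce
    then show ?thesis
      unfolding un using connectedin_Un IH last by blast
  qed
qed

text \<open>The initial segments are connected by the finite case and all contain
  \<open>X 1\<close>, which is nonempty because it meets \<open>X 2\<close>. Connected sets with a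
  common point have a connected union.\<close>

lemma connectedin_infinite_chain:
  fixes X :: "nat \<Rightarrow> 'a set"
  assumes conn: "\<And>i. 1 \<le> i \<Longrightarrow> connectedin T (X i)"
    and meet: "\<And>i. 2 \<le> i \<Longrightarrow> X (i - 1) \<inter> X i \<noteq> {}"
  shows "connectedin T (\<Union>i\<in>{1..}. X i)"
proof -
  have "X 1 \<noteq> {}"
    using meet[of 2] by auto
  \<comment> \<open>The index \<open>n\<close> starts at 1: the segment for \<open>n = 0\<close> is
    empty and would make the intersection empty.\<close>
  moreover have "X 1 \<subseteq> (\<Inter>n\<in>{1..}. \<Union>i\<in>{1..n}. X i)"
    by fastforce
  ultimately have "(\<Inter>n\<in>{1..}. \<Union>i\<in>{1..n}. X i) \<noteq> {}"
    by blast
  moreover have "connectedin T (\<Union>i\<in>{1..n}. X i)" for n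
    using conn meet by (intro connectedin_chain) auto
  ultimately have "connectedin T (\<Union>n\<in>{1..}. \<Union>i\<in>{1..n}. X i)"
    by (intro connectedin_Union) auto
  moreover have "(\<Union>n\<in>{1..}. \<Union>i\<in>{1..n}. X i) = (\<Union>i\<in>{1..}. X i)"
    by fastforce
  ultimately show ?thesis by simp
qed

theorem theorem4p4:
  fixes T :: "'a topology" and \<delta> :: "'a set \<Rightarrow> 'a set \<Rightarrow> bool"
  assumes "strong_proximity T \<delta>"
    and "proximity_connected T \<delta>"
  shows "connected_space T"
proof -
  obtain I X where
    I: "(\<exists>n\<ge>1. I = {1..n}) \<or> I = {1::nat..}" and
    cover: "topspace T = (\<Union>i\<in>I. X i)" and
    conn: "\<And>i. i \<in> I \<Longrightarrow> connectedin T (X i)" and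
    near: "\<And>i. i \<in> I \<Longrightarrow> 2 \<le> i \<Longrightarrow> \<delta> (X (i - 1)) (X i)"
    using assms(2) unfolding proximity_connected_def by metis
  have N2: "A \<inter> B \<noteq> {}" if "A \<subseteq> topspace T" "B \<subseteq> topspace T" "\<delta> A B" for A B
    using assms(1) that unfolding strong_proximity_def by simp
  have meet: "X (i - 1) \<inter> X i \<noteq> {}" if i: "i \<in> I" "2 \<le> i" for i
  proof (rule N2)
    \<comment> \<open>(N2) speaks only of subsets of the space, so \<open>X (i - 1)\<close> must
      itself belong to the cover. It does, since \<open>I\<close> is an initial segment of the
      positive integers and \<open>2 \<le> i\<close>.\<close>
    have "i - 1 \<in> I"
      using I i by auto
    then show "X (i - 1) \<subseteq> topspace T" "X i \<subseteq> topspace T"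
      using i conn connectedin_subset_topspace by blast+
  qed (use near i in blast)
  have "connectedin T (\<Union>i\<in>I. X i)"
    using I
  proof
    assume "\<exists>n\<ge>1. I = {1..n}"
    then obtain n where n: "I = {1..n}"
      by blast
    show ?thesis
      unfolding n using conn meet n by (intro connectedin_chain) auto
  next
    assume inf: "I = {1..}"
    show ?thesis
      unfolding inf using conn meet inf by (intro connectedin_infinite_chain) auto
  qed
  then show ?thesis
    by (simp add: cover[symmetric] connectedin_topspace)
qed

end
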